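(* Let $F$ be a field, $A$ a central simple algebra over $F$, and $\sigma: A \rightarrow A$ an involution of the first kind. Then the Lie algebra $\mathfrak{sl}^\sigma(2,A) = \{X \in \text{Mat}(2,A) : \hat{\sigma}(X) = -X\}$, with bracket $[X,Y] = XY - YX$, is isomorphic to the Lie algebra of the algebraic group $SL^\sigma(2,A)$.
   Context: An involution on a ring is an additive map $\sigma$ with $\sigma(\sigma(x))=x$ and $\sigma(xy)=\sigma(y)\sigma(x)$; on a central simple $F$-algebra it is of the first kind if it fixes $F$ pointwise. Define $\hat{\sigma}\begin{pmatrix} a & b \\ c & d\end{pmatrix} = \begin{pmatrix} \sigma(d) & -\sigma(b) \\ -\sigma(c) & \sigma(a)\end{pmatrix}$ on $\text{Mat}(2,A)$ and $SL^\sigma(2,A) = \{M\in\text{Mat}(2,A): M\hat{\sigma}(M) = I\}$, a closed subgroup of $GL(2,A)$. *)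

theory Defs
  imports "HOL-Analysis.Analysis" "HOL-Algebra.Coset" "HOL-Library.Poly_Mapping"
begin

section \<open>Dual numbers\<close>

text \<open>\<^term>\<open>Dual a b\<close> is \<open>a + \<epsilon> b\<close> with \<open>\<epsilon>\<^sup>2 = 0\<close>; thus the type \<open>'r dual\<close> is \<open>R[\<epsilon>]\<close>.\<close>

datatype 'r dual = Dual (re: 'r) (eps: 'r)

instantiation dual :: (comm_ring_1) comm_ring_1
begin

definition "0 = Dual 0 0"
definition "1 = Dual 1 0"
definition "x + y = Dual (re x + re y) (eps x + eps y)"
definition "x - y = Dual (re x - re y) (eps x - eps y)"
definition "- x = Dual (- re x) (- eps x)"
definition "x * y = Dual (re x * re y) (re x * eps y + eps x * re y)"

instance
  by standard
    (simp_all add: zero_dual_def one_dual_def plus_dual_def minus_dual_def uminus_dual_def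
      times_dual_def algebra_simps)

end


section \<open>Affine algebraic groups\<close>

type_synonym ('v, 'f) mpoly = "('v \<Rightarrow>\<^sub>0 nat) \<Rightarrow>\<^sub>0 'f"

definition Const :: "'f::comm_ring_1 \<Rightarrow> ('v, 'f) mpoly" where
  "Const c = Poly_Mapping.single 0 c"

definition Var :: "'v \<Rightarrow> ('v, 'f::comm_ring_1) mpoly" where
  "Var v = Poly_Mapping.single (Poly_Mapping.single v 1) 1"

text \<open>Evaluation at \<open>p\<close> in the commutative \<open>F\<close>-algebra \<open>R\<close> with structure map \<open>\<iota> : F \<rightarrow> R\<close>.\<close>

definition mpoly_eval ::
    "('f \<Rightarrow> 'r) \<Rightarrow> ('v \<Rightarrow> 'r) \<Rightarrow> ('v, 'f::comm_ring_1) mpoly \<Rightarrow> 'r::comm_ring_1" where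
  "mpoly_eval \<iota> p f =
     (\<Sum>m\<in>Poly_Mapping.keys f. \<iota> (Poly_Mapping.lookup f m) *
        (\<Prod>v\<in>Poly_Mapping.keys m. p v ^ Poly_Mapping.lookup m v))"

text \<open>An affine algebraic group over \<open>F\<close>, presented as the closed subscheme of the affine space
  with coordinates \<open>coords\<close> cut out by the polynomials \<open>eqns\<close>. The coordinates of a product of
  two points are given by the polynomials \<open>mul\<close>, in which the variables \<open>Inl v\<close> and \<open>Inr v\<close> are
  the coordinates of the left and of the right factor. The record is raw data: that the points in
  each \<open>F\<close>-algebra form a group is a property of the instance and not part of the type.\<close>

record (overloaded) ('v, 'f) affine_group =
  coords :: "'v set"
  eqns :: "('v, 'f) mpoly set"
  mul :: "'v \<Rightarrow> ('v + 'v, 'f) mpoly"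
  unit :: "'v \<Rightarrow> 'f"

text \<open>The group \<open>G(R)\<close> of points of \<open>G\<close> in the \<open>F\<close>-algebra \<open>(R, \<iota>)\<close>, and the map
  \<open>G(R) \<rightarrow> G(S)\<close> induced by a homomorphism \<open>h : R \<rightarrow> S\<close> of \<open>F\<close>-algebras.\<close>

definition points ::
    "('f \<Rightarrow> 'r) \<Rightarrow> ('v, 'f::field) affine_group \<Rightarrow> ('v \<Rightarrow> 'r::comm_ring_1) monoid" where
  "points \<iota> G =
     \<lparr>carrier = {p \<in> coords G \<rightarrow>\<^sub>E UNIV. \<forall>f\<in>eqns G. mpoly_eval \<iota> p f = 0},
      monoid.mult = (\<lambda>p q. \<lambda>v\<in>coords G. mpoly_eval \<iota> (case_sum p q) (mul G v)),
      one = (\<lambda>v\<in>coords G. \<iota> (unit G v))\<rparr>"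

definition induced ::
    "('v, 'f) affine_group \<Rightarrow> ('r \<Rightarrow> 's) \<Rightarrow> ('v \<Rightarrow> 'r) \<Rightarrow> ('v \<Rightarrow> 's)" where
  "induced G h p = (\<lambda>v\<in>coords G. h (p v))"


section \<open>Lie algebras\<close>

record ('f, 'l) lie = "'l partial_object" +
  lzero :: 'l
  ladd :: "'l \<Rightarrow> 'l \<Rightarrow> 'l"
  lsmult :: "'f \<Rightarrow> 'l \<Rightarrow> 'l"
  lbracket :: "'l \<Rightarrow> 'l \<Rightarrow> 'l"

locale lie_algebra =
  fixes L :: "('f::field, 'l) lie"
  assumes add_group: "comm_group \<lparr>carrier = carrier L, monoid.mult = ladd L, one = lzero L\<rparr>"
    and smult_closed: "x \<in> carrier L \<Longrightarrow> lsmult L c x \<in> carrier L"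
    and smult_add_right: "\<lbrakk>x \<in> carrier L; y \<in> carrier L\<rbrakk> \<Longrightarrow>
      lsmult L c (ladd L x y) = ladd L (lsmult L c x) (lsmult L c y)"
    and smult_add_left: "x \<in> carrier L \<Longrightarrow>
      lsmult L (c + d) x = ladd L (lsmult L c x) (lsmult L d x)"
    and smult_assoc: "x \<in> carrier L \<Longrightarrow> lsmult L (c * d) x = lsmult L c (lsmult L d x)"
    and smult_one: "x \<in> carrier L \<Longrightarrow> lsmult L 1 x = x"
    and bracket_closed: "\<lbrakk>x \<in> carrier L; y \<in> carrier L\<rbrakk> \<Longrightarrow> lbracket L x y \<in> carrier L"
    and bracket_add_left: "\<lbrakk>x \<in> carrier L; y \<in> carrier L; z \<in> carrier L\<rbrakk> \<Longrightarrow>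
      lbracket L (ladd L x y) z = ladd L (lbracket L x z) (lbracket L y z)"
    and bracket_add_right: "\<lbrakk>x \<in> carrier L; y \<in> carrier L; z \<in> carrier L\<rbrakk> \<Longrightarrow>
      lbracket L x (ladd L y z) = ladd L (lbracket L x y) (lbracket L x z)"
    and bracket_smult_left: "\<lbrakk>x \<in> carrier L; y \<in> carrier L\<rbrakk> \<Longrightarrow>
      lbracket L (lsmult L c x) y = lsmult L c (lbracket L x y)"
    and bracket_smult_right: "\<lbrakk>x \<in> carrier L; y \<in> carrier L\<rbrakk> \<Longrightarrow>
      lbracket L x (lsmult L c y) = lsmult L c (lbracket L x y)"
    and bracket_self: "x \<in> carrier L \<Longrightarrow> lbracket L x x = lzero L"
    and jacobi: "\<lbrakk>x \<in> carrier L; y \<in> carrier L; z \<in> carrier L\<rbrakk> \<Longrightarrow>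
      ladd L (lbracket L x (lbracket L y z))
        (ladd L (lbracket L y (lbracket L z x)) (lbracket L z (lbracket L x y))) = lzero L"

definition lie_isomorphic :: "('f::field, 'l) lie \<Rightarrow> ('f, 'm) lie \<Rightarrow> bool" where
  "lie_isomorphic L M \<longleftrightarrow> lie_algebra L \<and> lie_algebra M \<and>
     (\<exists>\<phi>. bij_betw \<phi> (carrier L) (carrier M) \<and>
       (\<forall>x\<in>carrier L. \<forall>y\<in>carrier L. \<phi> (ladd L x y) = ladd M (\<phi> x) (\<phi> y)) \<and>
       (\<forall>c. \<forall>x\<in>carrier L. \<phi> (lsmult L c x) = lsmult M c (\<phi> x)) \<and>
       (\<forall>x\<in>carrier L. \<forall>y\<in>carrier L. \<phi> (lbracket L x y) = lbracket M (\<phi> x) (\<phi> y)))"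

text \<open>The Lie algebra of an algebraic group in the functorial description of Demazure and
  Gabriel (Groupes algebriques, II, \<section>4): the kernel of \<open>G(F[\<epsilon>]) \<rightarrow> G(F)\<close>, \<open>\<epsilon> \<mapsto> 0\<close>,
  whose addition is the multiplication of \<open>G(F[\<epsilon>])\<close> and on which \<open>c \<in> F\<close> acts through
  \<open>\<epsilon> \<mapsto> c \<epsilon>\<close>. The bracket of \<open>x\<close> and \<open>y\<close> is the element \<open>z\<close> with
  \<open>z(\<epsilon>\<^sub>1 \<epsilon>\<^sub>2) = x(\<epsilon>\<^sub>1) y(\<epsilon>\<^sub>2) x(\<epsilon>\<^sub>1)\<inverse> y(\<epsilon>\<^sub>2)\<inverse>\<close> in \<open>G(F[\<epsilon>\<^sub>1, \<epsilon>\<^sub>2])\<close>, where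
  \<open>x(t)\<close> denotes the image of \<open>x\<close> under \<open>\<epsilon> \<mapsto> t\<close>. The algebra
  \<open>F[\<epsilon>\<^sub>1, \<epsilon>\<^sub>2]\<close>, with \<open>\<epsilon>\<^sub>1\<^sup>2 = \<epsilon>\<^sub>2\<^sup>2 = 0\<close>, is \<open>'f dual dual\<close>; its inner dual
  numbers are \<open>F[\<epsilon>\<^sub>1]\<close> and its outer \<open>\<epsilon>\<close> is \<open>\<epsilon>\<^sub>2\<close>.\<close>

definition dual_of :: "'r::comm_ring_1 \<Rightarrow> 'r dual" where
  "dual_of a = Dual a 0"

definition eps_to_eps1 :: "'f::field dual \<Rightarrow> 'f dual dual" where
  "eps_to_eps1 t = Dual (Dual (re t) (eps t)) (Dual 0 0)"

definition eps_to_eps2 :: "'f::field dual \<Rightarrow> 'f dual dual" where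
  "eps_to_eps2 t = Dual (Dual (re t) 0) (Dual (eps t) 0)"

definition eps_to_eps12 :: "'f::field dual \<Rightarrow> 'f dual dual" where
  "eps_to_eps12 t = Dual (Dual (re t) 0) (Dual 0 (eps t))"

definition Lie_carrier :: "('v, 'f::field) affine_group \<Rightarrow> ('v \<Rightarrow> 'f dual) set" where
  "Lie_carrier G = kernel (points dual_of G) (points id G) (induced G re)"

definition Lie_bracket ::
    "('v, 'f::field) affine_group \<Rightarrow> ('v \<Rightarrow> 'f dual) \<Rightarrow> ('v \<Rightarrow> 'f dual) \<Rightarrow> ('v \<Rightarrow> 'f dual)" where
  "Lie_bracket G x y =
     (let H = points (dual_of \<circ> dual_of) G;
          x1 = induced G eps_to_eps1 x;
          y2 = induced G eps_to_eps2 y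
      in THE z. z \<in> Lie_carrier G \<and>
           induced G eps_to_eps12 z = x1 \<otimes>\<^bsub>H\<^esub> y2 \<otimes>\<^bsub>H\<^esub> inv\<^bsub>H\<^esub> x1 \<otimes>\<^bsub>H\<^esub> inv\<^bsub>H\<^esub> y2)"

definition Lie :: "('v, 'f::field) affine_group \<Rightarrow> ('f, 'v \<Rightarrow> 'f dual) lie" where
  "Lie G =
     \<lparr>carrier = Lie_carrier G,
      lzero = \<one>\<^bsub>points dual_of G\<^esub>,
      ladd = (\<lambda>x y. x \<otimes>\<^bsub>points dual_of G\<^esub> y),
      lsmult = (\<lambda>c. induced G (\<lambda>t. Dual (re t) (c * eps t))),
      lbracket = Lie_bracket G\<rparr>"


section \<open>Central simple algebras with involution\<close>

text \<open>A central simple algebra is finite-dimensional; the locale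
  \<^locale>\<open>finite_dimensional_vector_space\<close> fixes some basis of it, which serves below to put
  coordinates on \<open>Mat(2, A)\<close>.\<close>

locale central_simple_algebra = finite_dimensional_vector_space smul B
  for smul :: "'f::field \<Rightarrow> 'a::ring_1 \<Rightarrow> 'a" and B :: "'a set" +
  assumes scale_mult_left: "smul c x * y = smul c (x * y)"
    and scale_mult_right: "x * smul c y = smul c (x * y)"
    and central: "(\<And>y. x * y = y * x) \<Longrightarrow> \<exists>c. x = smul c 1"
    and simple: "\<lbrakk>0 \<in> (I :: 'a set); \<And>x y. x \<in> I \<Longrightarrow> y \<in> I \<Longrightarrow> x + y \<in> I;
      \<And>a x. x \<in> I \<Longrightarrow> a * x \<in> I; \<And>a x. x \<in> I \<Longrightarrow> x * a \<in> I\<rbrakk> \<Longrightarrow> I = {0} \<or> I = UNIV"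

definition ring_involution :: "('a::ring_1 \<Rightarrow> 'a) \<Rightarrow> bool" where
  "ring_involution \<sigma> \<longleftrightarrow> (\<forall>x y. \<sigma> (x + y) = \<sigma> x + \<sigma> y) \<and> (\<forall>x. \<sigma> (\<sigma> x) = x) \<and>
     (\<forall>x y. \<sigma> (x * y) = \<sigma> y * \<sigma> x)"

definition first_kind :: "('f \<Rightarrow> 'a::ring_1 \<Rightarrow> 'a) \<Rightarrow> ('a \<Rightarrow> 'a) \<Rightarrow> bool" where
  "first_kind smul \<sigma> \<longleftrightarrow> (\<forall>c. \<sigma> (smul c 1) = smul c 1)"

definition sigma_hat :: "('a::ring_1 \<Rightarrow> 'a) \<Rightarrow> 'a^2^2 \<Rightarrow> 'a^2^2" where
  "sigma_hat \<sigma> M = vector [vector [\<sigma> (M$2$2), - \<sigma> (M$1$2)],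
                           vector [- \<sigma> (M$2$1), \<sigma> (M$1$1)]]"

definition sl_sigma :: "('f::field \<Rightarrow> 'a::ring_1 \<Rightarrow> 'a) \<Rightarrow> ('a \<Rightarrow> 'a) \<Rightarrow> ('f, 'a^2^2) lie" where
  "sl_sigma smul \<sigma> =
     \<lparr>carrier = {X. sigma_hat \<sigma> X = - X},
      lzero = 0,
      ladd = (+),
      lsmult = (\<lambda>c X. \<chi> i j. smul c (X$i$j)),
      lbracket = (\<lambda>X Y. X ** Y - Y ** X)\<rparr>"


section \<open>The algebraic group of M with M sigma-hat(M) = I\<close>

text \<open>\<open>E (i, j, b)\<close>, for \<open>b\<close> in a basis of \<open>A\<close>, form the induced basis of \<open>Mat(2, A)\<close>.\<close>

definition E :: "2 \<times> 2 \<times> 'a \<Rightarrow> ('a::ring_1)^2^2" where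
  "E = (\<lambda>(i, j, b). \<chi> k l. if k = i \<and> l = j then b else 0)"

definition coord ::
    "('f::field \<Rightarrow> 'a::ring_1 \<Rightarrow> 'a) \<Rightarrow> 'a set \<Rightarrow> 'a^2^2 \<Rightarrow> 2 \<times> 2 \<times> 'a \<Rightarrow> 'f" where
  "coord smul B X = (\<lambda>(i, j, b). module.representation smul B (X$i$j) b)"

text \<open>The polynomials are the coordinates of \<open>M \<sigma>\<close>-hat\<open>(M) - I\<close> for the generic matrix
  \<open>M = \<Sum>\<^sub>u x\<^sub>u E\<^sub>u\<close> (\<open>\<sigma>\<close>-hat being \<open>F\<close>-linear), and the coordinates of \<open>M N\<close> for generic \<open>M\<close>
  and \<open>N\<close>; so the points in \<open>R\<close> are the solutions of \<open>M \<sigma>\<close>-hat\<open>(M) = I\<close> in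
  \<open>Mat(2, A \<otimes> R)\<close>. Solutions are invertible, so the subscheme of \<open>Mat(2, A)\<close> cut out by these
  equations is the closed subgroup of \<open>GL(2, A)\<close> that they cut out.\<close>

definition SL_sigma_group ::
    "('f::field \<Rightarrow> 'a::ring_1 \<Rightarrow> 'a) \<Rightarrow> 'a set \<Rightarrow> ('a \<Rightarrow> 'a) \<Rightarrow> (2 \<times> 2 \<times> 'a, 'f) affine_group" where
  "SL_sigma_group smul B \<sigma> =
     (let V = UNIV \<times> UNIV \<times> B in
      \<lparr>coords = V,
       eqns = (\<lambda>v. (\<Sum>u\<in>V. \<Sum>w\<in>V.
                   Const (coord smul B (E u ** sigma_hat \<sigma> (E w)) v) * Var u * Var w)
                 - Const (coord smul B (mat 1) v)) ` V,
       mul = (\<lambda>v. \<Sum>u\<in>V. \<Sum>w\<in>V.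
                   Const (coord smul B (E u ** E w) v) * Var (Inl u) * Var (Inr w)),
       unit = coord smul B (mat 1)\<rparr>)"

end

theory Submission
  imports Defs
begin

text \<open>A point \<open>I + \<epsilon> X\<close> over \<open>F[\<epsilon>]\<close> satisfies \<open>M \<sigma>\<close>-hat\<open>(M) = I\<close> iff
  \<open>\<sigma>\<close>-hat\<open>(X) = - X\<close>, so \<open>X \<mapsto> I + \<epsilon> X\<close> is a bijection of \<open>sl\<^sup>\<sigma>(2, A)\<close> onto the
  kernel of \<open>G(F[\<epsilon>]) \<rightarrow> G(F)\<close>. It is linear since
  \<open>(I + \<epsilon> X)(I + \<epsilon> Y) = I + \<epsilon> (X + Y)\<close>, and it preserves brackets since the commutator of
  \<open>I + \<epsilon>\<^sub>1 X\<close> and \<open>I + \<epsilon>\<^sub>2 Y\<close> is \<open>I + \<epsilon>\<^sub>1 \<epsilon>\<^sub>2 (X Y - Y X)\<close>.\<close>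

section \<open>Transport of a Lie algebra structure along a bijection\<close>

text \<open>Elements of \<open>carrier M\<close> are images under \<open>\<phi>\<close>, so each
  axiom for \<open>M\<close> is the \<open>\<phi>\<close>-image of the same axiom for
  \<open>L\<close>. This spares a direct check, for instance of the Jacobi identity, in a Lie
  algebra whose bracket is defined by group commutators.\<close>

lemma lie_algebra_transfer:
  assumes L: "lie_algebra L"
    and bij: "bij_betw \<phi> (carrier L) (carrier M)"
    and zero: "\<phi> (lzero L) = lzero M"
    and add: "\<And>x y. \<lbrakk>x \<in> carrier L; y \<in> carrier L\<rbrakk> \<Longrightarrow> \<phi> (ladd L x y) = ladd M (\<phi> x) (\<phi> y)"
    and smult: "\<And>c x. x \<in> carrier L \<Longrightarrow> \<phi> (lsmult L c x) = lsmult M c (\<phi> x)"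
    and bracket: "\<And>x y. \<lbrakk>x \<in> carrier L; y \<in> carrier L\<rbrakk> \<Longrightarrow>
      \<phi> (lbracket L x y) = lbracket M (\<phi> x) (\<phi> y)"
  shows "lie_algebra M"
proof -
  interpret L: lie_algebra L by (rule L)
  let ?GL = "\<lparr>carrier = carrier L, monoid.mult = ladd L, one = lzero L\<rparr>"
  let ?GM = "\<lparr>carrier = carrier M, monoid.mult = ladd M, one = lzero M\<rparr>"
  interpret GL: comm_group ?GL by (rule L.add_group)
  have im: "carrier M = \<phi> ` carrier L"
    using bij by (simp add: bij_betw_def)
  have add_closed: "ladd L x y \<in> carrier L" if "x \<in> carrier L" "y \<in> carrier L" for x y
    using GL.m_closed that by simp
  have zero_closed: "lzero L \<in> carrier L"
    using GL.one_closed by simp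
  have comm_group: "comm_group ?GM"
  proof (rule comm_groupI, goal_cases)
    case (3 x y z)
    then show ?case using GL.m_assoc by (auto simp: im add[symmetric] add_closed)
  next
    case (4 x y)
    then show ?case using GL.m_comm by (auto simp: im add[symmetric])
  next
    case (5 x)
    then show ?case using GL.l_one by (auto simp: im add[symmetric] zero[symmetric] zero_closed)
  next
    case (6 x)
    then obtain a where a: "a \<in> carrier L" "x = \<phi> a" by (auto simp: im)
    from GL.l_inv_ex[of a] a obtain b where "b \<in> carrier L" "ladd L b a = lzero L" by auto
    with a show ?case by (auto simp: im add[symmetric] zero[symmetric] intro!: bexI[of _ b])
  qed (auto simp: im add[symmetric] zero[symmetric] add_closed zero_closed)
  show ?thesis
    by (rule lie_algebra.intro, rule comm_group)
      (auto simp: im add[symmetric] smult[symmetric] bracket[symmetric] zero[symmetric]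
        add_closed L.smult_closed L.bracket_closed L.smult_add_right L.smult_add_left L.smult_assoc
        L.smult_one L.bracket_add_left L.bracket_add_right L.bracket_smult_left
        L.bracket_smult_right L.bracket_self L.jacobi)
qed

section \<open>Evaluation of polynomials of degree at most two\<close>

text \<open>Monomials outside the support contribute \<open>\<iota> 0 = 0\<close>. A common index
  set \<open>K\<close> lets polynomials with different supports be compared term by term, even when
  cancellation shrinks the support of a sum.\<close>

lemma mpoly_eval_superset:
  assumes "finite K" "Poly_Mapping.keys f \<subseteq> K" "\<iota> 0 = 0"
  shows "mpoly_eval \<iota> p f = (\<Sum>m\<in>K. \<iota> (Poly_Mapping.lookup f m) *
    (\<Prod>v\<in>Poly_Mapping.keys m. p v ^ Poly_Mapping.lookup m v))"
  unfolding mpoly_eval_def using assms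
  by (intro sum.mono_neutral_left) (auto simp: in_keys_iff)

lemma mpoly_eval_add:
  assumes "\<And>a b. \<iota> (a + b) = \<iota> a + \<iota> b"
  shows "mpoly_eval \<iota> p (f + g) = mpoly_eval \<iota> p f + mpoly_eval \<iota> p g"
proof -
  have 0: "\<iota> 0 = 0" using assms[of 0 0] by simp
  let ?K = "Poly_Mapping.keys f \<union> Poly_Mapping.keys g"
  show ?thesis
    using mpoly_eval_superset[of ?K f \<iota> p] mpoly_eval_superset[of ?K g \<iota> p] 0
      mpoly_eval_superset[of ?K "f + g" \<iota> p] Poly_Mapping.keys_add[of f g]
    by (simp add: lookup_add assms distrib_right sum.distrib)
qed

lemma mpoly_eval_sum:
  assumes "\<And>a b. \<iota> (a + b) = \<iota> a + \<iota> b"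
  shows "mpoly_eval \<iota> p (\<Sum>i\<in>I. f i) = (\<Sum>i\<in>I. mpoly_eval \<iota> p (f i))"
  by (rule sum_comp_morphism[unfolded comp_def, symmetric])
     (simp_all add: mpoly_eval_add[where \<iota>=\<iota>, OF assms], simp add: mpoly_eval_def)

lemma mpoly_eval_diff:
  assumes "\<And>a b. \<iota> (a + b) = \<iota> a + \<iota> b"
  shows "mpoly_eval \<iota> p (f - g) = mpoly_eval \<iota> p f - mpoly_eval \<iota> p g"
  using mpoly_eval_add[where \<iota>=\<iota>, OF assms, of p "f - g" g] by simp

lemma mpoly_eval_Const:
  assumes "\<iota> 0 = 0"
  shows "mpoly_eval \<iota> p (Const c) = \<iota> c"
  using mpoly_eval_superset[of "{0}" "Const c" \<iota> p] assms by (simp add: Const_def)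

text \<open>All non-constant terms in \<open>eqns\<close> and \<open>mul\<close> of
  \<open>SL_sigma_group\<close> have this shape.\<close>

lemma mpoly_eval_quadratic_term:
  assumes "\<iota> 0 = 0"
  shows "mpoly_eval \<iota> p (Const c * Var u * Var w) = \<iota> c * p u * p w"
proof -
  let ?m = "Poly_Mapping.single u 1 + Poly_Mapping.single w (1::nat)"
  have "Const c * Var u * Var w = Poly_Mapping.single ?m c"
    by (simp add: Const_def Var_def mult_single)
  moreover have "mpoly_eval \<iota> p (Poly_Mapping.single ?m c) =
      \<iota> c * (\<Prod>v\<in>Poly_Mapping.keys ?m. p v ^ Poly_Mapping.lookup ?m v)"
    using mpoly_eval_superset[of "{?m}" "Poly_Mapping.single ?m c" \<iota> p] assms by simp
  moreover have "(\<Prod>v\<in>Poly_Mapping.keys ?m. p v ^ Poly_Mapping.lookup ?m v) =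
      (\<Prod>v\<in>{u, w}. p v ^ Poly_Mapping.lookup ?m v)"
    by (intro prod.mono_neutral_left) (auto simp: in_keys_iff lookup_add lookup_single when_def split: if_splits)
  \<comment> \<open>For \<open>u = w\<close> the index set is a singleton and the exponent is
    2.\<close>
  moreover have "\<dots> = p u * p w"
    by (cases "u = w") (auto simp: lookup_add lookup_single power2_eq_square)
  ultimately show ?thesis by (simp add: mult.assoc)
qed

section \<open>Components of dual numbers and arithmetic of matrices\<close>

lemma re_sum: "re (\<Sum>i\<in>I. f i) = (\<Sum>i\<in>I. re (f i))"
  by (rule sum_comp_morphism[unfolded comp_def, symmetric])
     (simp_all add: zero_dual_def plus_dual_def)

lemma eps_sum: "eps (\<Sum>i\<in>I. f i) = (\<Sum>i\<in>I. eps (f i))"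
  by (rule sum_comp_morphism[unfolded comp_def, symmetric])
     (simp_all add: zero_dual_def plus_dual_def)

lemmas dual_simps = re_sum eps_sum times_dual_def plus_dual_def dual_of_def zero_dual_def

text \<open>The action of F on Mat(2, A) gets a name because the F-structure of A is given by a
  parameter, not by the type of the entries.\<close>

definition mscale :: "('f \<Rightarrow> 'a \<Rightarrow> 'a) \<Rightarrow> 'f \<Rightarrow> 'a::ring_1^2^2 \<Rightarrow> 'a^2^2" where
  "mscale s c X = (\<chi> i j. s c (X$i$j))"

lemma dual_of_add: "dual_of (a + b) = dual_of a + dual_of b"
  by (simp add: dual_simps)

lemma dual_of_dual_of_add: "(dual_of \<circ> dual_of) (a + b) = (dual_of \<circ> dual_of) a + (dual_of \<circ> dual_of) b"
  by (simp add: dual_simps)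

lemma restrict_eq_iff: "restrict f A = restrict g A \<longleftrightarrow> (\<forall>v\<in>A. f v = g v)"
  by (metis restrict_apply' restrict_ext)

lemmas mat_eq_iff = vec_eq_iff forall_2

lemmas mat_simps = matrix_matrix_mult_def sigma_hat_def sum_2 mscale_def mat_def

lemma matrix_mult_zero_left: "0 ** X = 0"
  by (simp add: vec_eq_iff matrix_matrix_mult_def)

lemma matrix_mult_zero_right: "X ** 0 = 0"
  by (simp add: vec_eq_iff matrix_matrix_mult_def)

lemma matrix_mult_add_left: "(X + Y) ** Z = X ** Z + Y ** Z"
  by (simp add: vec_eq_iff matrix_matrix_mult_def sum.distrib distrib_right)

lemma matrix_mult_minus_left: "(- X) ** Y = - (X ** Y)" for X :: "'a::ring_1^'n^'m"
  by (simp add: vec_eq_iff matrix_matrix_mult_def sum_negf)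

lemma matrix_mult_minus_right: "X ** (- Y) = - (X ** Y)" for X :: "'a::ring_1^'n^'m"
  by (simp add: vec_eq_iff matrix_matrix_mult_def sum_negf)

lemma matrix_mult_diff_left: "(X - Y) ** Z = X ** Z - Y ** Z" for X :: "'a::ring_1^'n^'m"
  by (simp add: vec_eq_iff matrix_matrix_mult_def sum_subtractf left_diff_distrib)

lemma matrix_mult_diff_right: "Z ** (X - Y) = Z ** X - Z ** Y" for Z :: "'a::ring_1^'n^'m"
  by (simp add: vec_eq_iff matrix_matrix_mult_def sum_subtractf right_diff_distrib)

lemmas matrix_mult_simps = matrix_mult_zero_left matrix_mult_zero_right matrix_mult_minus_left
  matrix_mult_minus_right matrix_mult_diff_left matrix_mult_diff_right matrix_add_ldistrib
  matrix_mult_add_left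

section \<open>Linearity and multiplicativity of the involution on matrices\<close>

locale csa_involution = central_simple_algebra smul B
  for smul :: "'f::field \<Rightarrow> 'a::ring_1 \<Rightarrow> 'a" and B :: "'a set" +
  fixes \<sigma> :: "'a \<Rightarrow> 'a"
  assumes involution: "ring_involution \<sigma>" and first: "first_kind smul \<sigma>"
begin

abbreviation "V \<equiv> (UNIV :: 2 set) \<times> (UNIV :: 2 set) \<times> B"
abbreviation "G \<equiv> SL_sigma_group smul B \<sigma>"
abbreviation "mcoord \<equiv> coord smul B"
abbreviation "hat \<equiv> sigma_hat \<sigma>"

lemma sigma_add: "\<sigma> (x + y) = \<sigma> x + \<sigma> y"
  and sigma_mult: "\<sigma> (x * y) = \<sigma> y * \<sigma> x"
  using involution by (auto simp: ring_involution_def)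

lemma sigma_0: "\<sigma> 0 = 0"
  using sigma_add[of 0 0] by simp

lemma sigma_minus: "\<sigma> (- x) = - \<sigma> x"
  using sigma_add[of x "- x"] by (simp add: sigma_0 add_eq_0_iff)

lemma sigma_1: "\<sigma> 1 = 1"
  using first[unfolded first_kind_def, rule_format, of 1] by simp

text \<open>An involution of the first kind fixes the scalars \<open>smul c 1\<close>, and
  multiplying by them on either side is the F-action; so reversing the product
  \<open>smul c 1 * x\<close> does no harm.\<close>

lemma sigma_smul: "\<sigma> (smul c x) = smul c (\<sigma> x)"
proof -
  have "\<sigma> (smul c x) = \<sigma> (smul c 1 * x)" by (simp add: scale_mult_left)
  also have "\<dots> = \<sigma> x * smul c 1"
    using first by (simp add: sigma_mult first_kind_def)
  finally show ?thesis by (simp add: scale_mult_right)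
qed

lemma hat_add: "hat (X + Y) = hat X + hat Y"
  by (simp add: mat_eq_iff mat_simps sigma_add)

lemma hat_minus: "hat (- X) = - hat X"
  by (simp add: mat_eq_iff mat_simps sigma_minus)

lemma hat_diff: "hat (X - Y) = hat X - hat Y"
  using hat_add[of X "- Y"] by (simp add: hat_minus)

lemma hat_0: "hat 0 = 0"
  by (simp add: mat_eq_iff mat_simps sigma_0)

lemma hat_1: "hat (mat 1) = mat 1"
  by (simp add: mat_eq_iff mat_simps sigma_0 sigma_1)

text \<open>\<open>hat\<close> is the \<sigma>-conjugate transpose followed by conjugation with the
  matrix J with rows (0, 1) and (-1, 0), hence again an anti-automorphism. Here the four entries are
  compared directly.\<close>

lemma hat_mult: "hat (X ** Y) = hat Y ** hat X"
  by (simp add: mat_eq_iff mat_simps sigma_add sigma_minus sigma_mult add.commute)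

lemma hat_mscale: "hat (mscale smul c X) = mscale smul c (hat X)"
  by (simp add: mat_eq_iff mat_simps sigma_smul scale_minus_right)

lemma mult_mscale_left: "mscale smul c X ** Y = mscale smul c (X ** Y)"
  by (simp add: mat_eq_iff mat_simps scale_mult_left scale_right_distrib)

lemma mult_mscale_right: "X ** mscale smul c Y = mscale smul c (X ** Y)"
  by (simp add: mat_eq_iff mat_simps scale_mult_right scale_right_distrib)

section \<open>Coordinates on Mat(2, A) and expansion of bilinear maps\<close>

lemma in_span: "x \<in> span B"
  using span_Basis by auto

lemma coord_add: "mcoord (X + Y) v = mcoord X v + mcoord Y v"
  by (cases v) (simp add: coord_def representation_add[OF independent_Basis in_span in_span])

lemma coord_mscale: "mcoord (mscale smul c X) v = c * mcoord X v"
  by (cases v) (simp add: coord_def mscale_def representation_scale[OF independent_Basis in_span])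

lemma coord_0: "mcoord 0 v = 0"
  using coord_add[of 0 0] by (simp only: add_0_right add_cancel_right_right)

text \<open>Among the basis matrices only those supported at position \<open>(i, j)\<close>
  contribute to that entry.\<close>

lemma coord_sum_E: "(\<Sum>v\<in>V. mscale smul (p v) (E v)) $ i $ j = (\<Sum>b\<in>B. smul (p (i, j, b)) b)"
proof -
  have "(\<Sum>v\<in>V. mscale smul (p v) (E v)) $ i $ j =
      (\<Sum>k\<in>UNIV. \<Sum>l\<in>UNIV. \<Sum>b\<in>B. smul (p (k, l, b)) (E (k, l, b) $ i $ j))"
    by (simp add: mscale_def sum.cartesian_product case_prod_unfold)
  also have "\<dots> = (\<Sum>k\<in>UNIV. \<Sum>l\<in>UNIV. if k = i then if l = j then
      (\<Sum>b\<in>B. smul (p (i, j, b)) b) else 0 else 0)"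
    by (intro sum.cong refl) (auto simp: E_def)
  also have "\<dots> = (\<Sum>b\<in>B. smul (p (i, j, b)) b)"
    using exhaust_2[of i] exhaust_2[of j] by (auto simp: sum_2)
  finally show ?thesis .
qed

lemma coord_expansion: "(\<Sum>v\<in>V. mscale smul (mcoord X v) (E v)) = X"
  by (simp only: vec_eq_iff coord_sum_E)
    (simp add: coord_def sum_representation_eq[OF independent_Basis in_span finite_Basis subset_refl])

text \<open>Independence of \<open>B\<close> makes the coordinates of
  \<open>\<Sum>v\<in>V. mscale smul (p v) (E v)\<close> read back \<open>p\<close>. Together with
  \<open>coord_expansion\<close> this says that \<open>E\<close> is a basis indexed by
  \<open>V\<close>.\<close>

lemma coord_surj: "\<exists>X. \<forall>v\<in>V. mcoord X v = p v"
proof -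
  have "mcoord (\<Sum>v\<in>V. mscale smul (p v) (E v)) (i, j, b) = p (i, j, b)" if "b \<in> B" for i j b
    using that unfolding coord_def coord_sum_E split_conv
    by (subst representation_sum)
      (simp_all add: in_span independent_Basis representation_scale representation_basis
        finite_Basis if_distrib cong: if_cong)
  then show ?thesis by (intro exI[of _ "\<Sum>v\<in>V. mscale smul (p v) (E v)"]) auto
qed

lemma coord_inject: "(\<forall>v\<in>V. mcoord X v = mcoord Y v) \<longleftrightarrow> X = Y"
proof
  assume "\<forall>v\<in>V. mcoord X v = mcoord Y v"
  then have "(\<Sum>v\<in>V. mscale smul (mcoord X v) (E v)) = (\<Sum>v\<in>V. mscale smul (mcoord Y v) (E v))"
    by (intro sum.cong refl) auto
  then show "X = Y" by (simp only: coord_expansion)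
qed simp

lemma linear_form_expansion:
  assumes "\<And>X Y. f (X + Y) = f X + f Y" "\<And>c X. f (mscale smul c X) = c * f X"
  shows "f X = (\<Sum>v\<in>V. mcoord X v * f (E v))"
proof -
  have "f X = f (\<Sum>v\<in>V. mscale smul (mcoord X v) (E v))" by (simp only: coord_expansion)
  also have "\<dots> = (\<Sum>v\<in>V. f (mscale smul (mcoord X v) (E v)))"
    \<comment> \<open>The instance at 0 yields \<open>f 0 = 0\<close>, the value on the empty
      sum.\<close>
    using assms(1)[of 0 0] assms(1)
    by (intro sum_comp_morphism[unfolded comp_def, symmetric])
      (simp only: add_0_right add_cancel_right_right)
  finally show ?thesis by (simp add: assms(2))
qed

text \<open>For linear \<open>f\<close>, a coordinate of \<open>P ** f Q\<close> is bilinear in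
  \<open>P\<close> and \<open>Q\<close>, so it is expanded in one argument at a time. Taking
  \<open>f\<close> to be the identity handles the group law, taking \<open>f = hat\<close> the
  defining equations.\<close>

lemma coord_bilinear:
  assumes "\<And>X Y. f (X + Y) = f X + f Y" "\<And>c X. f (mscale smul c X) = mscale smul c (f X)"
  shows "(\<Sum>u\<in>V. \<Sum>w\<in>V. mcoord (E u ** f (E w)) v * mcoord P u * mcoord Q w) = mcoord (P ** f Q) v"
proof -
  have "mcoord (P ** f Q) v = (\<Sum>u\<in>V. mcoord P u * mcoord (E u ** f Q) v)"
    by (rule linear_form_expansion)
      (simp_all add: matrix_mult_add_left coord_add mult_mscale_left coord_mscale)
  also have "\<dots> = (\<Sum>u\<in>V. mcoord P u * (\<Sum>w\<in>V. mcoord Q w * mcoord (E u ** f (E w)) v))"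
  proof (intro sum.cong refl arg_cong2[of _ _ _ _ "(*)"])
    fix u
    show "mcoord (E u ** f Q) v = (\<Sum>w\<in>V. mcoord Q w * mcoord (E u ** f (E w)) v)"
      by (rule linear_form_expansion)
        (simp_all add: assms matrix_add_ldistrib coord_add mult_mscale_right coord_mscale)
  qed
  finally show ?thesis by (simp add: sum_distrib_left mult_ac)
qed

section \<open>Unit, product and equations of the points of the group\<close>

lemma coords_G: "coords G = V"
  by (simp add: SL_sigma_group_def Let_def)

lemma one_points: "\<one>\<^bsub>points \<iota> G\<^esub> = (\<lambda>v\<in>V. \<iota> (mcoord (mat 1) v))"
  by (simp add: points_def SL_sigma_group_def Let_def)

text \<open>Leaving \<open>\<iota>\<close> an arbitrary additive map covers both F[\<epsilon>] and
  its two-variable analogue.\<close>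

lemma mult_points:
  assumes "\<And>a b. \<iota> (a + b) = \<iota> a + \<iota> b"
  shows "p \<otimes>\<^bsub>points \<iota> G\<^esub> q =
    (\<lambda>v\<in>V. \<Sum>u\<in>V. \<Sum>w\<in>V. \<iota> (mcoord (E u ** E w) v) * p u * q w)"
proof -
  have "\<iota> 0 = 0" using assms[of 0 0] by simp
  then show ?thesis
    by (simp add: points_def SL_sigma_group_def Let_def mpoly_eval_sum assms mpoly_eval_quadratic_term)
qed

lemma carrier_points:
  assumes "\<And>a b. \<iota> (a + b) = \<iota> a + \<iota> b"
  shows "p \<in> carrier (points \<iota> G) \<longleftrightarrow> p \<in> extensional V \<and>
    (\<forall>v\<in>V. (\<Sum>u\<in>V. \<Sum>w\<in>V. \<iota> (mcoord (E u ** hat (E w)) v) * p u * p w) = \<iota> (mcoord (mat 1) v))"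
proof -
  have "\<iota> 0 = 0" using assms[of 0 0] by simp
  then show ?thesis
    by (simp add: points_def SL_sigma_group_def Let_def mpoly_eval_sum mpoly_eval_diff assms
        mpoly_eval_quadratic_term mpoly_eval_Const PiE_def)
qed

section \<open>Points over the dual numbers as tuples of matrices\<close>

text \<open>\<open>pt P Q\<close> is \<open>P + \<epsilon> Q\<close>, and \<open>pt2 P Q R S\<close> is
  \<open>P + \<epsilon>\<^sub>1 Q + \<epsilon>\<^sub>2 R + \<epsilon>\<^sub>1 \<epsilon>\<^sub>2 S\<close>.\<close>

definition pt :: "'a^2^2 \<Rightarrow> 'a^2^2 \<Rightarrow> 2 \<times> 2 \<times> 'a \<Rightarrow> 'f dual" where
  "pt P Q = (\<lambda>v\<in>V. Dual (mcoord P v) (mcoord Q v))"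

definition pt2 :: "'a^2^2 \<Rightarrow> 'a^2^2 \<Rightarrow> 'a^2^2 \<Rightarrow> 'a^2^2 \<Rightarrow> 2 \<times> 2 \<times> 'a \<Rightarrow> 'f dual dual" where
  "pt2 P Q R S = (\<lambda>v\<in>V. Dual (Dual (mcoord P v) (mcoord Q v)) (Dual (mcoord R v) (mcoord S v)))"

lemma pt_inject: "pt P Q = pt P' Q' \<longleftrightarrow> P = P' \<and> Q = Q'"
  unfolding pt_def restrict_eq_iff by (simp add: coord_inject[symmetric] ball_conj_distrib)

lemma pt2_inject: "pt2 P Q R S = pt2 P' Q' R' S' \<longleftrightarrow> P = P' \<and> Q = Q' \<and> R = R' \<and> S = S'"
  unfolding pt2_def restrict_eq_iff by (simp add: coord_inject[symmetric] ball_conj_distrib)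

text \<open>The real and infinitesimal parts of \<open>p\<close> are two families of scalars on
  \<open>V\<close>, each realised by a matrix through \<open>coord_surj\<close>.\<close>

lemma pt_exhaust:
  assumes "p \<in> extensional V"
  obtains P Q where "p = pt P Q"
proof -
  obtain P where "\<forall>v\<in>V. mcoord P v = re (p v)" using coord_surj[of "\<lambda>v. re (p v)"] by blast
  moreover obtain Q where "\<forall>v\<in>V. mcoord Q v = eps (p v)" using coord_surj[of "\<lambda>v. eps (p v)"] by blast
  ultimately have "p = pt P Q"
    using assms by (intro extensionalityI[of _ V]) (auto simp: pt_def)
  then show ?thesis by (rule that)
qed

lemma pt2_exhaust:
  assumes "p \<in> extensional V"
  obtains P Q R S where "p = pt2 P Q R S"
proof -
  obtain P where "\<forall>v\<in>V. mcoord P v = re (re (p v))" using coord_surj[of "\<lambda>v. re (re (p v))"] by blast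
  moreover obtain Q where "\<forall>v\<in>V. mcoord Q v = eps (re (p v))"
    using coord_surj[of "\<lambda>v. eps (re (p v))"] by blast
  moreover obtain R where "\<forall>v\<in>V. mcoord R v = re (eps (p v))"
    using coord_surj[of "\<lambda>v. re (eps (p v))"] by blast
  moreover obtain S where "\<forall>v\<in>V. mcoord S v = eps (eps (p v))"
    using coord_surj[of "\<lambda>v. eps (eps (p v))"] by blast
  ultimately have "p = pt2 P Q R S"
    using assms by (intro extensionalityI[of _ V]) (auto simp: pt2_def)
  then show ?thesis by (rule that)
qed

lemma one_pt: "\<one>\<^bsub>points dual_of G\<^esub> = pt (mat 1) 0"
  by (simp add: one_points pt_def dual_of_def coord_0)

lemma one_pt2: "\<one>\<^bsub>points (dual_of \<circ> dual_of) G\<^esub> = pt2 (mat 1) 0 0 0"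
  by (simp add: one_points pt2_def dual_simps coord_0)

lemma dual_bilinear:
  assumes "\<And>X Y. f (X + Y) = f X + f Y" "\<And>c X. f (mscale smul c X) = mscale smul c (f X)"
  shows "(\<Sum>u\<in>V. \<Sum>w\<in>V. dual_of (mcoord (E u ** f (E w)) v) * pt P Q u * pt P' Q' w) =
    Dual (mcoord (P ** f P') v) (mcoord (P ** f Q' + Q ** f P') v)"
proof -
  let ?c = "\<lambda>u w. mcoord (E u ** f (E w)) v"
  have "(\<Sum>u\<in>V. \<Sum>w\<in>V. dual_of (?c u w) * pt P Q u * pt P' Q' w) =
      (\<Sum>u\<in>V. \<Sum>w\<in>V. Dual (?c u w * mcoord P u * mcoord P' w)
        (?c u w * mcoord P u * mcoord Q' w + ?c u w * mcoord Q u * mcoord P' w))"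
    \<comment> \<open>The structure constant \<open>dual_of (?c u w)\<close> has no infinitesimal
      part, so it scales both components of the product.\<close>
    by (intro sum.cong refl) (simp add: dual_simps pt_def)
  then show ?thesis
    by (simp only: dual_simps sum.distrib coord_add coord_bilinear[where f=f, OF assms] dual.expand dual.sel)
qed

text \<open>Since both infinitesimals square to zero, only the coefficient of
  \<open>\<epsilon>\<^sub>1 \<epsilon>\<^sub>2\<close> mixes them: it receives the cross terms of
  \<open>Q\<close> with \<open>R'\<close> and of \<open>R\<close> with \<open>Q'\<close>.\<close>

lemma dual_dual_bilinear:
  assumes "\<And>X Y. f (X + Y) = f X + f Y" "\<And>c X. f (mscale smul c X) = mscale smul c (f X)"
  shows "(\<Sum>u\<in>V. \<Sum>w\<in>V. (dual_of \<circ> dual_of) (mcoord (E u ** f (E w)) v) *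
      pt2 P Q R S u * pt2 P' Q' R' S' w) =
    Dual (Dual (mcoord (P ** f P') v) (mcoord (P ** f Q' + Q ** f P') v))
      (Dual (mcoord (P ** f R' + R ** f P') v)
        (mcoord (P ** f S' + Q ** f R' + R ** f Q' + S ** f P') v))"
proof -
  let ?c = "\<lambda>u w. mcoord (E u ** f (E w)) v"
  have "(\<Sum>u\<in>V. \<Sum>w\<in>V. (dual_of \<circ> dual_of) (?c u w) * pt2 P Q R S u * pt2 P' Q' R' S' w) =
      (\<Sum>u\<in>V. \<Sum>w\<in>V. Dual
        (Dual (?c u w * mcoord P u * mcoord P' w)
          (?c u w * mcoord P u * mcoord Q' w + ?c u w * mcoord Q u * mcoord P' w))
        (Dual (?c u w * mcoord P u * mcoord R' w + ?c u w * mcoord R u * mcoord P' w)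
          (?c u w * mcoord P u * mcoord S' w + ?c u w * mcoord Q u * mcoord R' w +
           ?c u w * mcoord R u * mcoord Q' w + ?c u w * mcoord S u * mcoord P' w)))"
    by (intro sum.cong refl) (simp add: dual_simps pt2_def distrib_right)
  then show ?thesis
    by (simp only: dual_simps sum.distrib coord_add coord_bilinear[where f=f, OF assms] dual.expand dual.sel)
qed

lemma mult_pt: "pt P Q \<otimes>\<^bsub>points dual_of G\<^esub> pt P' Q' = pt (P ** P') (P ** Q' + Q ** P')"
  unfolding mult_points[where \<iota>=dual_of, OF dual_of_add]
    dual_bilinear[where f="\<lambda>X. X", OF refl refl]
  by (simp add: pt_def)

lemma mult_pt2: "pt2 P Q R S \<otimes>\<^bsub>points (dual_of \<circ> dual_of) G\<^esub> pt2 P' Q' R' S' =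
   pt2 (P ** P') (P ** Q' + Q ** P') (P ** R' + R ** P') (P ** S' + Q ** R' + R ** Q' + S ** P')"
  unfolding mult_points[where \<iota>="dual_of \<circ> dual_of", OF dual_of_dual_of_add]
    dual_dual_bilinear[where f="\<lambda>X. X", OF refl refl]
  by (simp add: pt2_def)

lemma pt_in_carrier: "pt P Q \<in> carrier (points dual_of G) \<longleftrightarrow>
  P ** hat P = mat 1 \<and> P ** hat Q + Q ** hat P = 0"
  unfolding carrier_points[where \<iota>=dual_of, OF dual_of_add]
    dual_bilinear[where f=hat, OF hat_add hat_mscale] coord_inject[symmetric]
  by (auto simp: dual_of_def coord_0 pt_def)

lemma pt2_in_carrier: "pt2 P Q R S \<in> carrier (points (dual_of \<circ> dual_of) G) \<longleftrightarrow>
  P ** hat P = mat 1 \<and> P ** hat Q + Q ** hat P = 0 \<and> P ** hat R + R ** hat P = 0 \<and>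
  P ** hat S + Q ** hat R + R ** hat Q + S ** hat P = 0"
  unfolding carrier_points[where \<iota>="dual_of \<circ> dual_of", OF dual_of_dual_of_add]
    dual_dual_bilinear[where f=hat, OF hat_add hat_mscale] coord_inject[symmetric]
  by (auto simp: dual_simps coord_0 pt2_def)

lemma carrier_points_dual_exhaust:
  assumes "p \<in> carrier (points dual_of G)"
  obtains P Q where "p = pt P Q"
  using assms pt_exhaust unfolding carrier_points[where \<iota>=dual_of, OF dual_of_add] by blast

lemma carrier_points_dual_dual_exhaust:
  assumes "p \<in> carrier (points (dual_of \<circ> dual_of) G)"
  obtains P Q R S where "p = pt2 P Q R S"
  using assms pt2_exhaust
  unfolding carrier_points[where \<iota>="dual_of \<circ> dual_of", OF dual_of_dual_of_add] by blast

section \<open>Kernel and commutator bracket of the group\<close>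

lemma Lie_carrier_G: "Lie_carrier G = pt (mat 1) ` {X. hat X = - X}"
proof -
  \<comment> \<open>Lying over the unit at \<epsilon> = 0 pins down the real part.\<close>
  have re: "induced G re (pt P Q) = \<one>\<^bsub>points id G\<^esub> \<longleftrightarrow> P = mat 1" for P Q
    unfolding induced_def one_points coords_G restrict_eq_iff by (simp add: pt_def coord_inject[symmetric])
  \<comment> \<open>With \<open>P = mat 1\<close> the first equation of \<open>pt_in_carrier\<close>
    is automatic and the second reads \<open>hat Q + Q = 0\<close>.\<close>
  have mem: "pt P Q \<in> Lie_carrier G \<longleftrightarrow> P = mat 1 \<and> hat Q = - Q" for P Q
    by (auto simp: Lie_carrier_def kernel_def pt_in_carrier re hat_1 eq_neg_iff_add_eq_0)
  show ?thesis
  proof (intro equalityI subsetI)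
    fix p assume p: "p \<in> Lie_carrier G"
    then obtain P Q where "p = pt P Q"
      by (auto simp: Lie_carrier_def kernel_def elim: carrier_points_dual_exhaust)
    with p show "p \<in> pt (mat 1) ` {X. hat X = - X}" by (auto simp: mem)
  qed (auto simp: mem)
qed

lemma induced_eps12: "induced G eps_to_eps12 (pt (mat 1) X) = pt2 (mat 1) 0 0 X"
  by (simp add: induced_def coords_G pt_def pt2_def eps_to_eps12_def coord_0 cong: restrict_cong)

text \<open>The product with the proposed inverse has
  \<open>\<epsilon>\<^sub>1 \<epsilon>\<^sub>2\<close>-coefficient
  \<open>- (X ** Y + Y ** X)\<close>, which vanishes when one of the two is zero. That is the case
  for the images of Lie algebra elements under \<open>eps_to_eps1\<close> and
  \<open>eps_to_eps2\<close>.\<close>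

lemma inv_pt2:
  assumes hat: "hat X = - X" "hat Y = - Y" and zero: "X = 0 \<or> Y = 0"
  shows "inv\<^bsub>points (dual_of \<circ> dual_of) G\<^esub> (pt2 (mat 1) X Y 0) = pt2 (mat 1) (- X) (- Y) 0"
  \<comment> \<open>The inverse is a definite description, so existence among the points and
    uniqueness are both shown by computation.\<close>
  unfolding m_inv_def one_pt2
proof (rule the_equality, goal_cases)
  case 1
  show ?case
    using zero by (auto simp: pt2_in_carrier mult_pt2 pt2_inject hat_1 hat_0 hat_minus hat matrix_mult_simps)
next
  case (2 y)
  then obtain P Q R S where "y = pt2 P Q R S" using carrier_points_dual_dual_exhaust by blast
  \<comment> \<open>Comparing coefficients in the product with \<open>y\<close> forces
    \<open>P = mat 1\<close>, \<open>Q = - X\<close>, \<open>R = - Y\<close> and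
    \<open>S = X ** Y + Y ** X = 0\<close>.\<close>
  with 2 zero show ?case
    by (auto simp: mult_pt2 pt2_inject matrix_mult_simps add_eq_0_iff2)
qed

text \<open>The two signs cancel in \<open>hat (X ** Y) = hat Y ** hat X = Y ** X\<close>, so
  \<open>hat\<close> swaps the two terms of the commutator.\<close>

lemma hat_commutator:
  assumes "hat X = - X" "hat Y = - Y"
  shows "hat (X ** Y - Y ** X) = - (X ** Y - Y ** X)"
  by (simp add: hat_diff hat_mult assms matrix_mult_simps)

lemma Lie_bracket_G:
  assumes "hat X = - X" "hat Y = - Y"
  shows "Lie_bracket G (pt (mat 1) X) (pt (mat 1) Y) = pt (mat 1) (X ** Y - Y ** X)"
proof -
  have eps1: "induced G eps_to_eps1 (pt (mat 1) X) = pt2 (mat 1) X 0 0"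
    and eps2: "induced G eps_to_eps2 (pt (mat 1) Y) = pt2 (mat 1) 0 Y 0"
    by (simp_all add: induced_def coords_G pt_def pt2_def eps_to_eps1_def eps_to_eps2_def coord_0
        cong: restrict_cong)
  have inv1: "inv\<^bsub>points (dual_of \<circ> dual_of) G\<^esub> (pt2 (mat 1) X 0 0) = pt2 (mat 1) (- X) 0 0"
    and inv2: "inv\<^bsub>points (dual_of \<circ> dual_of) G\<^esub> (pt2 (mat 1) 0 Y 0) = pt2 (mat 1) 0 (- Y) 0"
    using inv_pt2[of X 0] inv_pt2[of 0 Y] by (simp_all add: assms hat_0)
  show ?thesis
    unfolding Lie_bracket_def Let_def eps1 eps2 inv1 inv2 mult_pt2
    \<comment> \<open>The first three factors give \<open>pt2 (mat 1) 0 Y (X ** Y - Y ** X)\<close>,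
      and the last one removes \<open>Y\<close>. Uniqueness holds because
      \<open>induced_eps12\<close> keeps the matrix of a kernel element as the last
      component.\<close>
    by (rule the_equality)
      (auto simp: matrix_mult_simps Lie_carrier_G induced_eps12 pt_inject pt2_inject hat_commutator assms)
qed

section \<open>The matrix Lie algebra and the isomorphism\<close>

lemma lie_algebra_sl_sigma: "lie_algebra (sl_sigma smul \<sigma>)"
proof -
  have eq: "sl_sigma smul \<sigma> = \<lparr>carrier = {X. hat X = - X}, lzero = 0, ladd = (+),
      lsmult = mscale smul, lbracket = (\<lambda>X Y. X ** Y - Y ** X)\<rparr>"
    by (simp add: sl_sigma_def mscale_def[abs_def])
  have scale: "mscale smul c (X + Y) = mscale smul c X + mscale smul c Y"
    "mscale smul c (X - Y) = mscale smul c X - mscale smul c Y"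
    "mscale smul c (- X) = - mscale smul c X"
    "mscale smul (c + d) X = mscale smul c X + mscale smul d X"
    "mscale smul (c * d) X = mscale smul c (mscale smul d X)"
    "mscale smul 1 X = X" for c d X Y
    by (simp_all add: mscale_def vec_eq_iff algebra_simps)
  have "comm_group \<lparr>carrier = {X. hat X = - X}, monoid.mult = (+), one = 0\<rparr>"
  proof (rule comm_groupI, goal_cases)
    case (6 X)
    then show ?case by (auto intro!: exI[of _ "- X"] simp: hat_minus)
  qed (auto simp: hat_add hat_0 add_ac)
  then show ?thesis
    unfolding eq lie_algebra_def
    by (simp add: hat_mscale scale hat_commutator mult_mscale_left mult_mscale_right matrix_mult_simps)
       \<comment> \<open>Associativity serves the Jacobi identity, the only axiom with products of
         three matrices.\<close>
       (simp add: matrix_mul_assoc)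
qed

lemma lie_isomorphic_sl_sigma: "lie_isomorphic (sl_sigma smul \<sigma>) (Lie G)"
proof -
  let ?L = "sl_sigma smul \<sigma>" and ?\<phi> = "pt (mat 1)"
  have bij: "bij_betw ?\<phi> (carrier ?L) (carrier (Lie G))"
    by (auto simp: bij_betw_def inj_on_def pt_inject sl_sigma_def Lie_def Lie_carrier_G)
  have zero: "?\<phi> (lzero ?L) = lzero (Lie G)"
    by (simp add: sl_sigma_def Lie_def one_pt)
  \<comment> \<open>\<open>mult_pt\<close> delivers the infinitesimal part in the order
    \<open>Y + X\<close>.\<close>
  have add: "?\<phi> (ladd ?L X Y) = ladd (Lie G) (?\<phi> X) (?\<phi> Y)" for X Y
    by (simp add: sl_sigma_def Lie_def mult_pt add.commute)
  \<comment> \<open>The substitution of \<open>c\<close> \<epsilon> for \<epsilon> fixes the real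
    part and multiplies each infinitesimal coordinate by \<open>c\<close>, which is
    \<open>coord_mscale\<close>.\<close>
  have smult: "?\<phi> (lsmult ?L c X) = lsmult (Lie G) c (?\<phi> X)" for c X
    using coord_mscale[of c X]
    by (simp add: sl_sigma_def Lie_def induced_def coords_G pt_def mscale_def cong: restrict_cong)
  have bracket: "?\<phi> (lbracket ?L X Y) = lbracket (Lie G) (?\<phi> X) (?\<phi> Y)"
    if "X \<in> carrier ?L" "Y \<in> carrier ?L" for X Y
    using that by (simp add: sl_sigma_def Lie_def Lie_bracket_G)
  have "lie_algebra (Lie G)"
    using lie_algebra_transfer[OF lie_algebra_sl_sigma bij zero add smult bracket] .
  then show ?thesis
    unfolding lie_isomorphic_def using lie_algebra_sl_sigma bij add smult bracket by blast
qed

end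

theorem theorem3p6:
  fixes smul :: "'f::field \<Rightarrow> 'a::ring_1 \<Rightarrow> 'a"
    and B :: "'a set"
    and \<sigma> :: "'a \<Rightarrow> 'a"
  assumes "central_simple_algebra smul B"
    and "ring_involution \<sigma>"
    and "first_kind smul \<sigma>"
  shows "lie_isomorphic (sl_sigma smul \<sigma>) (Lie (SL_sigma_group smul B \<sigma>))"
proof -
  interpret csa_involution smul B \<sigma>
    using assms by (intro csa_involution.intro csa_involution_axioms.intro)
  show ?thesis by (rule lie_isomorphic_sl_sigma)
qed

end
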